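(* Let $n$ be an integer and $j$ a nonnegative integer, and let $\mathcal{G}_{n,j}$ and $\mathcal{S}_{n,j}$ be the sets of ordinary and signed Göllnitz–Gordon partitions defined in the context. Then the map $$g:\mathcal{G}_{n,j}\to\mathcal{S}_{n,j}$$ given by $$(\gamma_1,\gamma_2,\dots,\gamma_j)\;\mapsto\;\Big((\pi_1,\pi_2,\dots,\pi_j),\ \langle 1^{f_1}3^{f_3}\cdots(2j-1)^{f_{2j-1}}\rangle\Big),$$ where, for $1\le k\le j$, $$\pi_k=\gamma_k+4k-2j-2+P(\gamma_k)+2\sum_{i=k+1}^{j}P(\gamma_i)\qquad\text{and}\qquad f_{2k-1}=P(\gamma_k),$$ is a bijection.
   Context: A partition $\lambda$ with $j$ parts is a $j$-tuple of integers $(\lambda_1,\dots,\lambda_j)$ with $\lambda_1\ge\lambda_2\ge\dots\ge\lambda_j\ge 1$ (the empty partition, with no parts and weight $0$, is allowed). Its weight is $|\lambda|=\sum_{k=1}^j\lambda_k$ and its length is $\ell(\lambda)=j$. The notation $\langle 1^{f_1}2^{f_2}3^{f_3}\cdots\rangle$ denotes the partition having exactly $f_m$ parts equal to $m$ for each $m$; thus $\langle 1^{f_1}3^{f_3}\cdots(2j-1)^{f_{2j-1}}\rangle$ has exactly $f_{2k-1}$ parts equal to $2k-1$ for $1\le k\le j$ and no other parts. A signed partition $\sigma$ of an integer $n$ is a pair $(\pi,\nu)$ of (ordinary) partitions with $n=|\pi|-|\nu|$. The parity function is $P(k)=0$ if $k$ is even and $P(k)=1$ if $k$ is odd. $\mathcal{G}_{n,j}$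 is the set of partitions $\gamma=(\gamma_1,\dots,\gamma_j)$ of weight $n$ and length $j$ such that for all $1\le i\le j-1$: $\gamma_i-\gamma_{i+1}\ge 2$, and $\gamma_i-\gamma_{i+1}>2$ if $\gamma_i$ is even. $\mathcal{S}_{n,j}$ is the set of signed partitions $\sigma=(\pi,\nu)$ of $n$ such that: $\ell(\pi)=j$; $\ell(\nu)\le j$; every $\pi_i$ ($1\le i\le j$) is even and $\pi_i\ge 2j$; every $\nu_i$ ($1\le i\le\ell(\nu)$) is odd and $\nu_i\le 2j-1$; and $\nu_i-\nu_{i+1}\ge 2$ for all $1\le i\le\ell(\nu)-1$. *)

theory Defs
  imports Main
begin

definition is_partition :: "int list \<Rightarrow> bool" where
  "is_partition p \<longleftrightarrow> sorted_wrt (\<ge>) p \<and> (\<forall>x\<in>set p. x \<ge> 1)"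

definition weight :: "int list \<Rightarrow> int" where
  "weight p = sum_list p"

text \<open>Lists are indexed from 0 but the parts of a partition are numbered from 1.\<close>

definition part :: "int list \<Rightarrow> nat \<Rightarrow> int" where
  "part p k = p ! (k - 1)"

definition signed_partitions :: "int \<Rightarrow> (int list \<times> int list) set" where
  "signed_partitions n =
     {(p, q). is_partition p \<and> is_partition q \<and> n = weight p - weight q}"

definition parity :: "int \<Rightarrow> nat" where
  "parity k = (if even k then 0 else 1)"

text \<open>The partition with exactly \<open>F k\<close> parts equal to \<open>2 * k - 1\<close> for \<open>1 \<le> k \<le> j\<close> and no other
  parts, largest parts first; \<open>F k\<close> is the frequency with subscript \<open>2 * k - 1\<close>.\<close>

definition odd_freq_partition :: "nat \<Rightarrow> (nat \<Rightarrow> nat) \<Rightarrow> int list" where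
  "odd_freq_partition j F =
     concat (map (\<lambda>k. replicate (F k) (2 * int k - 1)) (rev [1..<Suc j]))"

lemma set_odd_freq_partition:
  "set (odd_freq_partition j F) = {2 * int k - 1 |k. 1 \<le> k \<and> k \<le> j \<and> F k \<noteq> 0}"
  by (auto simp: odd_freq_partition_def)

lemma odd_freq_partition_Suc:
  "odd_freq_partition (Suc j) F = replicate (F (Suc j)) (2 * int (Suc j) - 1) @ odd_freq_partition j F"
  by (simp add: odd_freq_partition_def)

lemma is_partition_odd_freq_partition: "is_partition (odd_freq_partition j F)"
proof (induction j)
  case 0
  then show ?case by (simp add: is_partition_def odd_freq_partition_def)
next
  case (Suc j)
  have "sorted_wrt (\<ge>) (replicate n (x::int))" for n x
    by (induction n) auto
  with Suc show ?case
    by (auto simp: is_partition_def odd_freq_partition_Suc set_odd_freq_partition sorted_wrt_append)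
qed

lemma count_list_odd_freq_partition:
  "count_list (odd_freq_partition j F) (2 * int k - 1) = (if 1 \<le> k \<and> k \<le> j then F k else 0)"
proof (induction j)
  case 0
  then show ?case by (simp add: odd_freq_partition_def)
next
  case (Suc j)
  have "count_list (replicate n (x::int)) y = (if x = y then n else 0)" for n x y
    by (induction n) auto
  moreover have "2 * int (Suc j) - 1 = 2 * int k - 1 \<longleftrightarrow> k = Suc j"
    by presburger
  ultimately show ?case
    using Suc by (auto simp del: of_nat_Suc simp add: odd_freq_partition_Suc)
qed

definition GG_partitions :: "int \<Rightarrow> nat \<Rightarrow> int list set" where
  "GG_partitions n j =
     {c. is_partition c \<and> weight c = n \<and> length c = j \<and>
         (\<forall>i. 1 \<le> i \<and> i \<le> j - 1 \<longrightarrow>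
            part c i - part c (i + 1) \<ge> 2 \<and>
            (even (part c i) \<longrightarrow> part c i - part c (i + 1) > 2))}"

definition signed_GG_partitions :: "int \<Rightarrow> nat \<Rightarrow> (int list \<times> int list) set" where
  "signed_GG_partitions n j =
     {(p, q) \<in> signed_partitions n.
        length p = j \<and> length q \<le> j \<and>
        (\<forall>i. 1 \<le> i \<and> i \<le> j \<longrightarrow> even (part p i) \<and> part p i \<ge> 2 * int j) \<and>
        (\<forall>i. 1 \<le> i \<and> i \<le> length q \<longrightarrow> odd (part q i) \<and> part q i \<le> 2 * int j - 1) \<and>
        (\<forall>i. 1 \<le> i \<and> i \<le> length q - 1 \<longrightarrow> part q i - part q (i + 1) \<ge> 2)}"

definition GG_pi :: "nat \<Rightarrow> int list \<Rightarrow> nat \<Rightarrow> int" where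
  "GG_pi j c k =
     part c k + 4 * int k - 2 * int j - 2 + int (parity (part c k))
       + 2 * (\<Sum>i = k + 1..j. int (parity (part c i)))"

definition GG_map :: "nat \<Rightarrow> int list \<Rightarrow> int list \<times> int list" where
  "GG_map j c =
     (map (GG_pi j c) [1..<Suc j], odd_freq_partition j (\<lambda>k. parity (part c k)))"

end

theory Submission
  imports Defs
begin

text \<open>
  Write \<open>\<pi>\<^sub>k = \<gamma>\<^sub>k + s\<^sub>k\<close>, where \<open>s\<^sub>k\<close> depends only on the parities of the \<open>\<gamma>\<^sub>i\<close>. Then
  \<open>\<pi>\<^sub>k - \<pi>\<^sub>k\<^sub>+\<^sub>1 = \<gamma>\<^sub>k - \<gamma>\<^sub>k\<^sub>+\<^sub>1 - 4 + P(\<gamma>\<^sub>k) + P(\<gamma>\<^sub>k\<^sub>+\<^sub>1)\<close>, and since the right-hand side is even, its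
  nonnegativity is equivalent to the gap conditions on \<open>\<gamma>\<close>. The total shift is
  \<open>\<Sum>\<^sub>k (2 k - 1) P(\<gamma>\<^sub>k) = |\<nu>|\<close>, which gives the weight condition. Since \<open>\<nu>\<close> has distinct odd parts
  it records exactly the parities of the \<open>\<gamma>\<^sub>k\<close>, so subtracting \<open>s\<^sub>k\<close> again inverts the map.
\<close>

section \<open>Lists and their parts\<close>

lemma part_map_upt: "1 \<le> k \<Longrightarrow> k \<le> j \<Longrightarrow> part (map f [1..<Suc j]) k = f k"
  by (simp add: part_def nth_append del: upt_Suc)

lemma map_part_upt: "map (part c) [1..<Suc (length c)] = c"
  by (rule nth_equalityI) (simp_all add: part_def del: upt_Suc)

lemma list_eq_iff_part:
  assumes "length c = j" "length d = j" "\<And>k. 1 \<le> k \<Longrightarrow> k \<le> j \<Longrightarrow> part c k = part d k"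
  shows "c = d"
proof -
  have "map (part c) [1..<Suc j] = map (part d) [1..<Suc j]"
    using assms(3) by (auto simp del: upt_Suc)
  with assms(1,2) map_part_upt show ?thesis by metis
qed

lemma weight_map_upt: "weight (map f [1..<Suc j]) = (\<Sum>k = 1..j. f k)"
  by (simp add: weight_def interv_sum_list_conv_sum_set_nat atLeastLessThanSuc_atLeastAtMost
      del: upt_Suc)

lemma weight_eq_sum_part: "weight c = (\<Sum>k = 1..length c. part c k)"
  by (metis map_part_upt weight_map_upt)

lemma ball_set_iff_part: "(\<forall>x\<in>set c. Q x) \<longleftrightarrow> (\<forall>k. 1 \<le> k \<and> k \<le> length c \<longrightarrow> Q (part c k))"
  by (subst map_part_upt [symmetric]) (auto simp: less_Suc_eq_le simp del: upt_Suc)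

lemma sorted_wrt_iff_part:
  assumes "transp R"
  shows "sorted_wrt R c \<longleftrightarrow> (\<forall>k. 1 \<le> k \<and> k < length c \<longrightarrow> R (part c k) (part c (k + 1)))"
proof -
  have "(\<forall>i. Suc i < length c \<longrightarrow> R (c ! i) (c ! Suc i)) \<longleftrightarrow>
      (\<forall>k. 1 \<le> k \<and> k < length c \<longrightarrow> R (part c k) (part c (k + 1)))"
    unfolding part_def by (metis One_nat_def Suc_le_D Suc_eq_plus1 diff_Suc_1 le_add2)
  with assms show ?thesis by (simp add: sorted_wrt_iff_nth_Suc_transp)
qed

lemma is_partition_iff_part:
  "is_partition c \<longleftrightarrow>
     (\<forall>k. 1 \<le> k \<and> k < length c \<longrightarrow> part c (k + 1) \<le> part c k) \<and>
     (\<forall>k. 1 \<le> k \<and> k \<le> length c \<longrightarrow> 1 \<le> part c k)"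
proof -
  have "transp ((\<ge>) :: int \<Rightarrow> int \<Rightarrow> bool)" by (auto intro: transpI)
  then show ?thesis by (simp add: is_partition_def ball_set_iff_part sorted_wrt_iff_part)
qed

text \<open>Both positivity of \<open>c\<close> and the bound \<open>2 * int j\<close> on
  \<open>p\<close> reduce in this way to the last part, where the shift has a closed form.\<close>

lemma part_lower_bound:
  assumes "\<And>k. 1 \<le> k \<Longrightarrow> k < j \<Longrightarrow> part c (k + 1) \<le> part c k" "b \<le> part c j" "1 \<le> k" "k \<le> j"
  shows "b \<le> part c k"
  using \<open>k \<le> j\<close> \<open>1 \<le> k\<close>
proof (induction k rule: inc_induct)
  case base
  then show ?case using assms(2) by simp
next
  case (step m)
  then show ?case using assms(1)[of m] by simp
qed

section \<open>Partitions into odd parts\<close>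

lemma weight_odd_freq_partition:
  "weight (odd_freq_partition j F) = (\<Sum>k = 1..j. int (F k) * (2 * int k - 1))"
  by (induction j) (simp_all add: odd_freq_partition_def weight_def sum_list_replicate algebra_simps)

lemma length_odd_freq_partition: "length (odd_freq_partition j F) = (\<Sum>k = 1..j. F k)"
  by (induction j) (simp_all add: odd_freq_partition_def)

text \<open>Frequencies at most 1 make the parts distinct, and distinct odd numbers differ by at
  least 2.\<close>

lemma sorted_odd_freq_partition:
  assumes "\<And>k. F k \<le> 1"
  shows "sorted_wrt (\<lambda>x y. y + 2 \<le> x) (odd_freq_partition j F)"
proof (induction j)
  case 0
  then show ?case by (simp add: odd_freq_partition_def)
next
  case (Suc j)
  have "F (Suc j) = 0 \<or> F (Suc j) = 1" using assms[of "Suc j"] by auto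
  with Suc show ?case
    by (auto simp: odd_freq_partition_Suc set_odd_freq_partition)
qed

lemma transp_gap: "transp (\<lambda>x y :: int. y + 2 \<le> x)"
  by (auto intro: transpI)

text \<open>Both lists are strictly decreasing, hence determined by their sets of entries. Thus
  \<open>q\<close> can be recovered from the frequencies read off it.\<close>

lemma odd_freq_partition_indicator:
  assumes q: "sorted_wrt (\<lambda>x y. y + 2 \<le> x) q"
    and odd: "\<And>x. x \<in> set q \<Longrightarrow> odd x \<and> 1 \<le> x \<and> x \<le> 2 * int j - 1"
  shows "odd_freq_partition j (\<lambda>k. if 2 * int k - 1 \<in> set q then 1 else 0) = q"
    (is "odd_freq_partition j ?F = q")
proof -
  \<comment> \<open>Reversal turns the lists into increasing ones, as
    \<open>strict_sorted_equal\<close> requires.\<close>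
  have gap: "sorted_wrt (<) (rev l)" if "sorted_wrt (\<lambda>x y. y + 2 \<le> x) l" for l :: "int list"
    using that by (auto simp: sorted_wrt_rev intro: sorted_wrt_mono_rel[rotated])
  have "set (odd_freq_partition j ?F) = set q"
  proof
    show "set q \<subseteq> set (odd_freq_partition j ?F)"
    proof
      fix x assume x: "x \<in> set q"
      from odd[OF x] obtain m where m: "x = 2 * m + 1" by (auto elim: oddE)
      with odd[OF x] have "x = 2 * int (nat (m + 1)) - 1" "1 \<le> nat (m + 1)" "nat (m + 1) \<le> j"
        by auto
      with x show "x \<in> set (odd_freq_partition j ?F)"
        unfolding set_odd_freq_partition by force
    qed
  qed (auto simp: set_odd_freq_partition split: if_splits)
  moreover have "sorted_wrt (<) (rev (odd_freq_partition j ?F))" "sorted_wrt (<) (rev q)"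
    using q by (auto intro!: gap sorted_odd_freq_partition)
  ultimately have "rev (odd_freq_partition j ?F) = rev q"
    by (intro strict_sorted_equal) auto
  then show ?thesis by simp
qed

section \<open>The shift\<close>

text \<open>The frequencies are a parameter so that one formula serves both directions:
  \<open>F\<close> is the parity of the parts of \<open>c\<close> for the map, and the indicator of
  the parts of \<open>q\<close> for its inverse.\<close>

definition GG_shift :: "nat \<Rightarrow> (nat \<Rightarrow> nat) \<Rightarrow> nat \<Rightarrow> int" where
  "GG_shift j F k =
     4 * int k - 2 * int j - 2 + int (F k) + 2 * (\<Sum>i = k + 1..j. int (F i))"

lemma GG_pi_eq: "GG_pi j c k = part c k + GG_shift j (\<lambda>i. parity (part c i)) k"
  by (simp add: GG_pi_def GG_shift_def)

lemma GG_shift_cong: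
  assumes "\<And>i. 1 \<le> i \<Longrightarrow> i \<le> j \<Longrightarrow> F i = G i" "1 \<le> k" "k \<le> j"
  shows "GG_shift j F k = GG_shift j G k"
proof -
  have "(\<Sum>i = k + 1..j. int (F i)) = (\<Sum>i = k + 1..j. int (G i))"
    using assms by (intro sum.cong) auto
  with assms show ?thesis by (simp add: GG_shift_def)
qed

text \<open>From \<open>k\<close> to \<open>k + 1\<close> the term \<open>F k\<close> disappears and
  the coefficient of \<open>F (k + 1)\<close> drops from 2 to 1.\<close>

lemma GG_shift_step:
  assumes "k < j"
  shows "GG_shift j F (k + 1) = GG_shift j F k + 4 - int (F k) - int (F (k + 1))"
proof -
  have "(\<Sum>i = k + 1..j. int (F i)) = int (F (k + 1)) + (\<Sum>i = k + 2..j. int (F i))"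
    using assms by (subst sum.atLeast_Suc_atMost) auto
  then show ?thesis by (simp add: GG_shift_def)
qed

lemma GG_shift_last: "GG_shift j F j = 2 * int j - 2 + int (F j)"
  by (simp add: GG_shift_def)

lemma even_GG_shift: "even (GG_shift j F k) \<longleftrightarrow> even (F k)"
  by (simp add: GG_shift_def)

text \<open>Passing from \<open>j\<close> to \<open>j + 1\<close> changes each of the
  \<open>j\<close> old shifts by \<open>2 * F (j + 1) - 2\<close> and adds the new one
  \<open>2 * j + F (j + 1)\<close>. The total change is \<open>(2 * j + 1) * F (j + 1)\<close>, the
  contribution of the new odd part.\<close>

lemma sum_GG_shift: "(\<Sum>k = 1..j. GG_shift j F k) = weight (odd_freq_partition j F)"
proof (induction j)
  case 0
  then show ?case by (simp add: weight_odd_freq_partition)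
next
  case (Suc j)
  have "GG_shift (Suc j) F k = GG_shift j F k - 2 + 2 * int (F (Suc j))" if "k \<le> j" for k
    using that by (simp add: GG_shift_def)
  then have "(\<Sum>k = 1..j. GG_shift (Suc j) F k)
      = (\<Sum>k = 1..j. GG_shift j F k + (2 * int (F (Suc j)) - 2))"
    by (intro sum.cong) auto
  also have "\<dots> = (\<Sum>k = 1..j. GG_shift j F k) + int j * (2 * int (F (Suc j)) - 2)"
    by (simp add: sum.distrib)
  finally show ?case
    using Suc by (simp add: weight_odd_freq_partition GG_shift_last algebra_simps)
qed

section \<open>The bijection\<close>

lemma part_fst_GG_map:
  "1 \<le> k \<Longrightarrow> k \<le> j \<Longrightarrow>
     part (fst (GG_map j c)) k = part c k + GG_shift j (\<lambda>i. parity (part c i)) k"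
  by (simp add: GG_map_def part_map_upt GG_pi_eq del: upt_Suc One_nat_def)

lemma even_add_parity: "even (x + int (parity x))"
  by (simp add: parity_def)

lemma parity_le_1: "parity x \<le> 1"
  by (simp add: parity_def)

lemma GG_partitionsD:
  assumes "c \<in> GG_partitions n j"
  shows "length c = j" "weight c = n"
    "\<And>k. 1 \<le> k \<Longrightarrow> k \<le> j \<Longrightarrow> 1 \<le> part c k"
    "\<And>k. 1 \<le> k \<Longrightarrow> k < j \<Longrightarrow> part c (k + 1) + 2 \<le> part c k"
    "\<And>k. 1 \<le> k \<Longrightarrow> k < j \<Longrightarrow> even (part c k) \<Longrightarrow> part c (k + 1) + 2 < part c k"
  using assms by (fastforce simp: GG_partitions_def is_partition_iff_part)+

text \<open>The weak order of \<open>q\<close> comes from its gaps, and positivity of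
  \<open>p\<close> from the bound \<open>2 * int j\<close>, which is at least 2 once
  \<open>p\<close> has a part.\<close>

lemma signed_GG_partitions_iff:
  "(p, q) \<in> signed_GG_partitions n j \<longleftrightarrow>
     length p = j \<and> length q \<le> j \<and> n = weight p - weight q \<and>
     (\<forall>k. 1 \<le> k \<and> k < j \<longrightarrow> part p (k + 1) \<le> part p k) \<and>
     (\<forall>k. 1 \<le> k \<and> k \<le> j \<longrightarrow> even (part p k) \<and> 2 * int j \<le> part p k) \<and>
     sorted_wrt (\<lambda>x y. y + 2 \<le> x) q \<and>
     (\<forall>x\<in>set q. odd x \<and> 1 \<le> x \<and> x \<le> 2 * int j - 1)" (is "?L \<longleftrightarrow> ?R")
proof
  assume ?L
  then show ?R
    unfolding signed_GG_partitions_def signed_partitions_def is_partition_iff_part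
      ball_set_iff_part sorted_wrt_iff_part[OF transp_gap]
    by (auto simp: algebra_simps)
next
  assume R: ?R
  then show ?L
    unfolding signed_GG_partitions_def signed_partitions_def is_partition_iff_part
      ball_set_iff_part sorted_wrt_iff_part[OF transp_gap]
    by (force simp: algebra_simps)
qed

lemma GG_map_in_signed_GG_partitions:
  assumes c: "c \<in> GG_partitions n j"
  shows "GG_map j c \<in> signed_GG_partitions n j"
proof -
  note c = GG_partitionsD[OF c]
  define F where "F = (\<lambda>k. parity (part c k))"
  define p where "p = fst (GG_map j c)"
  have map: "GG_map j c = (p, odd_freq_partition j F)"
    by (simp add: p_def F_def GG_map_def)
  have len: "length p = j"
    by (simp add: p_def GG_map_def del: upt_Suc)
  have part: "part p k = part c k + GG_shift j F k" if "1 \<le> k" "k \<le> j" for k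
    using that by (simp add: p_def F_def part_fst_GG_map)
  have even: "even (part p k)" if "1 \<le> k" "k \<le> j" for k
    using that by (simp add: part even_GG_shift) (simp add: F_def parity_def)
  have mono: "part p (k + 1) \<le> part p k" if k: "1 \<le> k" "k < j" for k
  proof -
    from k have "part p k - part p (k + 1)
        = part c k - part c (k + 1) - 4 + int (F k) + int (F (k + 1))"
      using part[of k] part[of "k + 1"] GG_shift_step[of k j F] by simp
    moreover have "even (part p k - part p (k + 1))"
      using even k by simp
    \<comment> \<open>An odd part has gap at least 2 and \<open>F k = 1\<close>; an even part has
      gap at least 3 and \<open>F k = 0\<close>. So the difference of the parts of \<open>p\<close>
      is at least -1, and being even it is nonnegative.\<close>
    moreover have "part c k - part c (k + 1) + int (F k) \<ge> 3"
      using c(4,5)[of k] k by (auto simp: F_def parity_def)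
    ultimately show ?thesis by presburger
  qed
  have "2 * int j \<le> part p k" if "1 \<le> k" "k \<le> j" for k
  proof (rule part_lower_bound[OF mono _ that])
    \<comment> \<open>A positive even number is at least 2, which cancels the -2 in
      \<open>GG_shift_last\<close>.\<close>
    have "even (part c j + int (F j))" unfolding F_def by (rule even_add_parity)
    moreover have "1 \<le> part c j" using c(3) that by simp
    ultimately have "2 \<le> part c j + int (F j)" by presburger
    then show "2 * int j \<le> part p j"
      using that by (simp add: part GG_shift_last)
  qed simp_all
  moreover have "n = weight p - weight (odd_freq_partition j F)"
  proof -
    have "weight p = (\<Sum>k = 1..j. part c k + GG_shift j F k)"
      by (simp add: weight_eq_sum_part len part)
    then show ?thesis
      using c(1,2) by (simp add: sum.distrib sum_GG_shift weight_eq_sum_part[of c]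
          del: One_nat_def)
  qed
  moreover have "length (odd_freq_partition j F) \<le> j"
    using sum_bounded_above[of "{1..j}" F 1]
    by (simp add: length_odd_freq_partition F_def parity_le_1 del: One_nat_def)
  moreover have "sorted_wrt (\<lambda>x y. y + 2 \<le> x) (odd_freq_partition j F)"
    by (intro sorted_odd_freq_partition) (simp add: F_def parity_le_1 del: One_nat_def)
  moreover have "odd x \<and> 1 \<le> x \<and> x \<le> 2 * int j - 1" if "x \<in> set (odd_freq_partition j F)" for x
    using that by (auto simp: set_odd_freq_partition)
  ultimately show ?thesis
    unfolding map signed_GG_partitions_iff using len mono even by blast
qed

lemma GG_map_eqD:
  assumes "GG_map j c = GG_map j d" "length c = j" "length d = j"
  shows "c = d"
proof (rule list_eq_iff_part[OF assms(2,3)])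
  \<comment> \<open>The multiplicity of \<open>2 * i - 1\<close> in the second component is the
    parity of the \<open>i\<close>-th part, so \<open>c\<close> and \<open>d\<close> have the same
    shifts.\<close>
  have F: "parity (part c i) = parity (part d i)" if "1 \<le> i" "i \<le> j" for i
    using arg_cong[OF assms(1), of "\<lambda>x. count_list (snd x) (2 * int i - 1)"] that
    by (simp add: GG_map_def count_list_odd_freq_partition)
  fix k assume k: "1 \<le> k" "k \<le> j"
  then show "part c k = part d k"
    using part_fst_GG_map[of k j c] part_fst_GG_map[of k j d] assms(1) GG_shift_cong[OF F k]
    by simp
qed

text \<open>The preimage is explicit: read the parities off \<open>q\<close> and subtract the
  resulting shift from \<open>p\<close>.\<close>

lemma signed_GG_partitions_subset_image:
  assumes "(p, q) \<in> signed_GG_partitions n j"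
  shows "(p, q) \<in> GG_map j ` GG_partitions n j"
proof -
  have len: "length p = j" and n: "n = weight p - weight q"
    and mono: "\<And>k. 1 \<le> k \<Longrightarrow> k < j \<Longrightarrow> part p (k + 1) \<le> part p k"
    and even: "\<And>k. 1 \<le> k \<Longrightarrow> k \<le> j \<Longrightarrow> even (part p k) \<and> 2 * int j \<le> part p k"
    and q: "sorted_wrt (\<lambda>x y. y + 2 \<le> x) q"
      "\<And>x. x \<in> set q \<Longrightarrow> odd x \<and> 1 \<le> x \<and> x \<le> 2 * int j - 1"
    using assms unfolding signed_GG_partitions_iff by blast+
  define F :: "nat \<Rightarrow> nat" where "F = (\<lambda>k. if 2 * int k - 1 \<in> set q then 1 else 0)"
  have qF: "odd_freq_partition j F = q"
    unfolding F_def using q by (rule odd_freq_partition_indicator)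
  have F: "F k = 0 \<or> F k = 1" for k
    by (simp add: F_def)
  define c where "c = map (\<lambda>k. part p k - GG_shift j F k) [1..<Suc j]"
  have lenc: "length c = j"
    by (simp add: c_def del: upt_Suc)
  have part: "part c k = part p k - GG_shift j F k" if "1 \<le> k" "k \<le> j" for k
    using that by (simp add: c_def part_map_upt del: upt_Suc One_nat_def)
  \<comment> \<open>Since \<open>p\<close> has even parts, each part of \<open>c\<close> has the
    parity of its shift, which is that of \<open>F k\<close>. Hence \<open>GG_map\<close> adds back
    exactly the shift subtracted here.\<close>
  have parity: "parity (part c k) = F k" if "1 \<le> k" "k \<le> j" for k
    using that F[of k] even[of k] by (auto simp: part parity_def even_GG_shift)
  have gap: "part c (k + 1) + 4 \<le> part c k + int (F k) + int (F (k + 1))"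
    if k: "1 \<le> k" "k < j" for k
    using k mono[OF k] part[of k] part[of "k + 1"] GG_shift_step[of k j F] by simp
  have gap2: "part c (k + 1) + 2 \<le> part c k" if k: "1 \<le> k" "k < j" for k
    using gap[OF k] F[of k] F[of "k + 1"] by auto
  \<comment> \<open>An even part forces \<open>F k = 0\<close>, so \<open>gap\<close> leaves a
    difference of at least 3.\<close>
  have gap3: "part c (k + 1) + 2 < part c k" if k: "1 \<le> k" "k < j" "even (part c k)" for k
    using gap[OF k(1,2)] F[of "k + 1"] parity[of k] k by (auto simp: parity_def)
  have pos: "1 \<le> part c k" if "1 \<le> k" "k \<le> j" for k
  proof (rule part_lower_bound[OF _ _ that])
    show "part c (i + 1) \<le> part c i" if "1 \<le> i" "i < j" for i
      using gap2[OF that] by simp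
    \<comment> \<open>Here \<open>part p j\<close> is at least \<open>2 * j\<close> and the shift is
      \<open>2 * j - 2 + F j\<close>, so at least \<open>2 - F j\<close> remains.\<close>
    show "1 \<le> part c j"
      using that even[of j] F[of j] by (auto simp: part GG_shift_last)
  qed
  have "weight c = weight p - weight q"
    by (simp add: weight_eq_sum_part[of c] weight_eq_sum_part[of p] lenc len part sum_subtractf
        sum_GG_shift qF del: One_nat_def)
  then have "c \<in> GG_partitions n j"
    using lenc n pos gap2 gap3
    by (force simp: GG_partitions_def is_partition_iff_part algebra_simps)
  moreover have "GG_map j c = (p, q)"
  proof -
    have "part (fst (GG_map j c)) k = part p k" if "1 \<le> k" "k \<le> j" for k
      using that GG_shift_cong[OF parity that] by (simp add: part_fst_GG_map part)
    then have "fst (GG_map j c) = p"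
      using len by (intro list_eq_iff_part[of _ j]) (simp_all add: GG_map_def del: upt_Suc)
    moreover have "odd_freq_partition j (\<lambda>k. parity (part c k)) = odd_freq_partition j F"
      unfolding odd_freq_partition_def using parity
      by (intro arg_cong[of _ _ concat] map_cong) (auto simp del: upt_Suc)
    ultimately show ?thesis
      using qF by (simp add: GG_map_def)
  qed
  ultimately show ?thesis by force
qed

theorem theorem4:
  fixes n :: int and j :: nat
  shows "bij_betw (GG_map j) (GG_partitions n j) (signed_GG_partitions n j)"
  unfolding bij_betw_def
proof
  show "inj_on (GG_map j) (GG_partitions n j)"
    by (intro inj_onI) (metis GG_map_eqD GG_partitionsD(1))
  show "GG_map j ` GG_partitions n j = signed_GG_partitions n j"
    using GG_map_in_signed_GG_partitions signed_GG_partitions_subset_image by auto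
qed

end
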